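(* Let $A$ be an $m\times n$ real matrix, $p\in\mathbb{R}^n$, $b\in\mathbb{R}^m$, and let $\bar{x}\in\mathbb{R}^n$ be an optimal solution of the linear programming problem $$\text{Maximize } p^T x \text{ subject to } Ax=b,\ x\geq 0.$$ If $x^*\in\mathbb{R}^n$ satisfies $x^*\geq 0$ and $\{j \mid x^*_j>0\}\subset\{j\mid \bar{x}_j>0\}$, then $x^*$ is an optimal solution of the linear programming problem $$\text{Maximize } p^T x \text{ subject to } Ax=Ax^*,\ x\geq 0.$$
   Context: For vectors $z,w$ of the same finite dimension, $z\geq w$ means that each coordinate of $z$ is greater than or equal to the corresponding coordinate of $w$. The symbol $\subset$ denotes (not necessarily strict) inclusion. An optimal solution of a maximization problem is a feasible point at which the maximum of the objective over the feasible set is attained; it is not assumed to be basic. *)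

theory Defs
  imports "HOL-Analysis.Analysis"
begin

text \<open>The order on \<^typ>\<open>real ^ 'n\<close> is the coordinatewise one.\<close>

definition lp_feasible :: "real ^ 'n ^ 'm \<Rightarrow> real ^ 'm \<Rightarrow> (real ^ 'n) set"
  where "lp_feasible A b = {x. A *v x = b \<and> x \<ge> 0}"

definition lp_optimal :: "real ^ 'n \<Rightarrow> real ^ 'n ^ 'm \<Rightarrow> real ^ 'm \<Rightarrow> real ^ 'n \<Rightarrow> bool"
  where "lp_optimal p A b x \<longleftrightarrow>
    x \<in> lp_feasible A b \<and> (\<forall>y \<in> lp_feasible A b. p \<bullet> y \<le> p \<bullet> x)"

end

theory Submission
  imports Defs
begin

text \<open>
  A feasible point \<open>y\<close> that beats \<open>xstar\<close> gives a direction \<open>y - xstar\<close> in the kernel of \<open>A\<close>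
  along which the objective increases. The same direction can be followed from \<open>xbar\<close>, for a
  short while: only coordinates in the support of \<open>xstar\<close> can decrease along it, and there
  \<open>xbar\<close> is positive. So \<open>xbar\<close> could be improved, against its optimality. The step length
  comes from scaling \<open>xstar\<close> below \<open>xbar\<close>, as in the following lemma.
\<close>

text \<open>Each coordinate admits a positive factor, and as there are finitely many coordinates the
  least of these factors is still positive.\<close>

lemma positive_multiple_le_if_support_subset:
  fixes u v :: "real ^ 'n"
  assumes u: "u \<ge> 0" and v: "v \<ge> 0"
    and support: "{j. u $ j > 0} \<subseteq> {j. v $ j > 0}"
  obtains e :: real where "e > 0" and "e *\<^sub>R u \<le> v"
proof -
  define r where "r j = (if u $ j > 0 then v $ j / u $ j else 1)" for j
  define e where "e = Min (range r)"
  have "r j > 0" for j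
    using support by (auto simp: r_def)
  then have "e > 0"
    by (auto simp: e_def)
  have "e * u $ j \<le> v $ j" for j
  proof (cases "u $ j > 0")
    case True
    have "e \<le> r j"
      by (simp add: e_def)
    with True show ?thesis
      by (simp add: r_def field_simps)
  next
    case False
    with u have "u $ j = 0"
      by (simp add: less_eq_vec_def order.antisym not_less)
    with v show ?thesis
      by (simp add: less_eq_vec_def)
  qed
  then have "e *\<^sub>R u \<le> v"
    by (simp add: less_eq_vec_def)
  with \<open>e > 0\<close> show thesis
    by (rule that)
qed

theorem theorem1:
  fixes A :: "real ^ 'n ^ 'm" and p :: "real ^ 'n" and b :: "real ^ 'm"
    and xbar xstar :: "real ^ 'n"
  assumes "lp_optimal p A b xbar"
    and "xstar \<ge> 0"
    and "{j. xstar $ j > 0} \<subseteq> {j. xbar $ j > 0}"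
  shows "lp_optimal p A (A *v xstar) xstar"
proof -
  have xbar: "A *v xbar = b" "xbar \<ge> 0"
    and optimal: "\<And>x. A *v x = b \<Longrightarrow> x \<ge> 0 \<Longrightarrow> p \<bullet> x \<le> p \<bullet> xbar"
    using assms(1) by (auto simp: lp_optimal_def lp_feasible_def)
  obtain e where e: "e > 0" "e *\<^sub>R xstar \<le> xbar"
    using positive_multiple_le_if_support_subset assms(2) xbar(2) assms(3) by blast
  have "p \<bullet> y \<le> p \<bullet> xstar" if y: "A *v y = A *v xstar" "y \<ge> 0" for y
  proof -
    let ?x = "xbar + e *\<^sub>R (y - xstar)"
    have "A *v ?x = b"
      using y(1) xbar(1)
      by (simp add: matrix_vector_right_distrib matrix_vector_mult_diff_distrib
          matrix_vector_mult_scaleR)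
    moreover have "?x \<ge> 0"
    proof -
      \<comment> \<open>\<open>?x\<close> is the sum of \<open>xbar - e *\<^sub>R xstar\<close> and \<open>e *\<^sub>R y\<close>, both nonnegative.\<close>
      have "0 \<le> ?x $ j" for j
      proof -
        have "e * xstar $ j \<le> xbar $ j" "0 \<le> e * y $ j"
          using e y(2) by (simp_all add: less_eq_vec_def)
        then show ?thesis
          by (simp add: right_diff_distrib)
      qed
      then show ?thesis
        by (simp add: less_eq_vec_def)
    qed
    ultimately have "p \<bullet> ?x \<le> p \<bullet> xbar"
      by (rule optimal)
    then have "e * (p \<bullet> y - p \<bullet> xstar) \<le> 0"
      by (simp add: inner_add_right inner_diff_right)
    with e(1) show ?thesis
      by (simp add: mult_le_0_iff)
  qed
  with assms(2) show ?thesis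
    by (simp add: lp_optimal_def lp_feasible_def)
qed

end
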